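(* For every set of formulas $\Gamma\cup\{\varphi\}\subseteq \mathbf{F}(\Sigma_{\mathbf{nbI}},\mathcal V)$: if $\Gamma\vdash_{\mathbf{nbI}}\varphi$ then $\Gamma\vDash_{\mathbf{nbI}}\varphi$.
   Context: Let $\mathcal V$ be a countable set of propositional variables and $\Sigma_{\mathbf{nbI}}=\{\vee,\wedge,\rightarrow,\uparrow,\neg\}$ with $\neg$ unary and the other connectives binary; $\mathbf F(\Sigma_{\mathbf{nbI}},\mathcal V)$ is the set of formulas. The logic $\mathbf{nbI}$ is the Hilbert calculus whose only inference rule is Modus Ponens and whose axioms are all instances (with arbitrary formulas) of: (1) $\alpha\to(\beta\to\alpha)$; (2) $(\alpha\to(\beta\to\gamma))\to((\alpha\to\beta)\to(\alpha\to\gamma))$; (3) $\alpha\to(\beta\to(\alpha\wedge\beta))$; (4) $(\alpha\wedge\beta)\to\alpha$; (5) $(\alpha\wedge\beta)\to\beta$; (6) $\alpha\to(\alpha\vee\beta)$; (7) $\beta\to(\alpha\vee\beta)$; (8) $(\alpha\to\gamma)\to((\beta\to\gamma)\to((\alpha\vee\beta)\to\gamma))$; (9) $(\alpha\to\beta)\vee\alpha$; (Ip) $(\alpha\uparrow\beta)\to(\alpha\to(\beta\to\gamma))$; (Comm) $(\alpha\uparrow\beta)\to(\beta\uparrow\alpha)$; (11) $\alpha\vee\neg\alpha$. $\Gamma\vdash_{\mathbf{nbI}}\varphi$ means that there is a finite derivation of $\varphi$ from premises in $\Gamma$. A bivaluation for $\mathbf{nbI}$ is a map $\nu:\mathbf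 F(\Sigma_{\mathbf{nbI}},\mathcal V)\to\{0,1\}$ such that for all formulas $\alpha,\beta$: $\nu(\alpha\vee\beta)=1$ iff $\nu(\alpha)=1$ or $\nu(\beta)=1$; $\nu(\alpha\wedge\beta)=1$ iff $\nu(\alpha)=\nu(\beta)=1$; $\nu(\alpha\to\beta)=1$ iff $\nu(\alpha)=0$ or $\nu(\beta)=1$; if $\nu(\alpha\uparrow\beta)=1$ then $\nu(\alpha)=0$ or $\nu(\beta)=0$; $\nu(\alpha\uparrow\beta)=\nu(\beta\uparrow\alpha)$; if $\nu(\neg\alpha)=0$ then $\nu(\alpha)=1$. $\Gamma\vDash_{\mathbf{nbI}}\varphi$ means: for every bivaluation $\nu$ for $\mathbf{nbI}$, if $\nu(\gamma)=1$ for all $\gamma\in\Gamma$ then $\nu(\varphi)=1$. *)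

theory Defs
  imports Main "HOL-Library.Countable"
begin

datatype 'v fm =
    Var 'v
  | Or "'v fm" "'v fm"  (infixr "\<^bold>\<or>" 54)
  | And "'v fm" "'v fm"  (infixr "\<^bold>\<and>" 55)
  | Imp "'v fm" "'v fm"  (infixr "\<^bold>\<rightarrow>" 53)
  | Up "'v fm" "'v fm"  (infix "\<^bold>\<up>" 56)
  | Neg "'v fm"  ("\<^bold>\<not> _" [57] 57)

inductive_set nbI_axioms :: "'v fm set" where
  Ax1: "(\<alpha> \<^bold>\<rightarrow> (\<beta> \<^bold>\<rightarrow> \<alpha>)) \<in> nbI_axioms"
| Ax2: "((\<alpha> \<^bold>\<rightarrow> (\<beta> \<^bold>\<rightarrow> \<gamma>)) \<^bold>\<rightarrow> ((\<alpha> \<^bold>\<rightarrow> \<beta>) \<^bold>\<rightarrow> (\<alpha> \<^bold>\<rightarrow> \<gamma>))) \<in> nbI_axioms"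
| Ax3: "(\<alpha> \<^bold>\<rightarrow> (\<beta> \<^bold>\<rightarrow> (\<alpha> \<^bold>\<and> \<beta>))) \<in> nbI_axioms"
| Ax4: "((\<alpha> \<^bold>\<and> \<beta>) \<^bold>\<rightarrow> \<alpha>) \<in> nbI_axioms"
| Ax5: "((\<alpha> \<^bold>\<and> \<beta>) \<^bold>\<rightarrow> \<beta>) \<in> nbI_axioms"
| Ax6: "(\<alpha> \<^bold>\<rightarrow> (\<alpha> \<^bold>\<or> \<beta>)) \<in> nbI_axioms"
| Ax7: "(\<beta> \<^bold>\<rightarrow> (\<alpha> \<^bold>\<or> \<beta>)) \<in> nbI_axioms"
| Ax8: "((\<alpha> \<^bold>\<rightarrow> \<gamma>) \<^bold>\<rightarrow> ((\<beta> \<^bold>\<rightarrow> \<gamma>) \<^bold>\<rightarrow> ((\<alpha> \<^bold>\<or> \<beta>) \<^bold>\<rightarrow> \<gamma>))) \<in> nbI_axioms"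
| Ax9: "((\<alpha> \<^bold>\<rightarrow> \<beta>) \<^bold>\<or> \<alpha>) \<in> nbI_axioms"
| Ip: "((\<alpha> \<^bold>\<up> \<beta>) \<^bold>\<rightarrow> (\<alpha> \<^bold>\<rightarrow> (\<beta> \<^bold>\<rightarrow> \<gamma>))) \<in> nbI_axioms"
| Comm: "((\<alpha> \<^bold>\<up> \<beta>) \<^bold>\<rightarrow> (\<beta> \<^bold>\<up> \<alpha>)) \<in> nbI_axioms"
| Ax11: "(\<alpha> \<^bold>\<or> (\<^bold>\<not> \<alpha>)) \<in> nbI_axioms"

definition nbI_derivation :: "'v fm set \<Rightarrow> 'v fm list \<Rightarrow> bool" where
  "nbI_derivation \<Gamma> ds \<longleftrightarrow>
     (\<forall>i < length ds.
        ds ! i \<in> \<Gamma> \<or> ds ! i \<in> nbI_axioms \<or>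
        (\<exists>j < i. \<exists>k < i. ds ! k = (ds ! j \<^bold>\<rightarrow> ds ! i)))"

definition nbI_derives :: "'v fm set \<Rightarrow> 'v fm \<Rightarrow> bool"  (infix "\<turnstile>nbI" 50) where
  "\<Gamma> \<turnstile>nbI \<phi> \<longleftrightarrow> (\<exists>ds. ds \<noteq> [] \<and> nbI_derivation \<Gamma> ds \<and> last ds = \<phi>)"

(* The truth values 1 and 0 are rendered as True and False. Only necessary conditions are
   imposed on the values of Up and Neg, so \<nu> is not determined by its values on variables. *)
definition nbI_bivaluation :: "('v fm \<Rightarrow> bool) \<Rightarrow> bool" where
  "nbI_bivaluation \<nu> \<longleftrightarrow>
     (\<forall>\<alpha> \<beta>. \<nu> (\<alpha> \<^bold>\<or> \<beta>) \<longleftrightarrow> \<nu> \<alpha> \<or> \<nu> \<beta>) \<and>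
     (\<forall>\<alpha> \<beta>. \<nu> (\<alpha> \<^bold>\<and> \<beta>) \<longleftrightarrow> \<nu> \<alpha> \<and> \<nu> \<beta>) \<and>
     (\<forall>\<alpha> \<beta>. \<nu> (\<alpha> \<^bold>\<rightarrow> \<beta>) \<longleftrightarrow> \<not> \<nu> \<alpha> \<or> \<nu> \<beta>) \<and>
     (\<forall>\<alpha> \<beta>. \<nu> (\<alpha> \<^bold>\<up> \<beta>) \<longrightarrow> \<not> \<nu> \<alpha> \<or> \<not> \<nu> \<beta>) \<and>
     (\<forall>\<alpha> \<beta>. \<nu> (\<alpha> \<^bold>\<up> \<beta>) = \<nu> (\<beta> \<^bold>\<up> \<alpha>)) \<and>
     (\<forall>\<alpha>. \<not> \<nu> (\<^bold>\<not> \<alpha>) \<longrightarrow> \<nu> \<alpha>)"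

definition nbI_entails :: "'v fm set \<Rightarrow> 'v fm \<Rightarrow> bool"  (infix "\<Turnstile>nbI" 50) where
  "\<Gamma> \<Turnstile>nbI \<phi> \<longleftrightarrow> (\<forall>\<nu>. nbI_bivaluation \<nu> \<longrightarrow> (\<forall>\<gamma>\<in>\<Gamma>. \<nu> \<gamma>) \<longrightarrow> \<nu> \<phi>)"

end

theory Submission
  imports Defs
begin

text \<open>
  Soundness holds because the set of formulas that a fixed bivaluation makes true contains every
  axiom instance and is closed under Modus Ponens.  A bivaluation is not truth-functional: it only
  constrains the values of \<open>\<^bold>\<up>\<close> and \<open>\<^bold>\<not>\<close>.  The argument goes through because each
  axiom that mentions these connectives needs just one such constraint:
  incompatibility of \<open>\<alpha>\<close> and \<open>\<beta>\<close> when \<open>\<alpha> \<^bold>\<up> \<beta>\<close> is true gives \<open>Ip\<close>, symmetry of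
  \<open>\<^bold>\<up>\<close> gives \<open>Comm\<close>, and the clause for \<open>\<^bold>\<not>\<close> gives excluded middle.  The other axioms are
  classical tautologies in connectives that a bivaluation does interpret classically.
  Truth then propagates along a derivation, each line depending only on earlier ones.
\<close>

text \<open>
  Separate rules allow each axiom to be checked with only the clauses that it rests on.  In
  particular the symmetry clause for \<open>\<^bold>\<up>\<close>, an equation that can be rewritten back and forth,
  enters only where \<open>Comm\<close> is treated.
\<close>

lemma nbI_bivaluation_clauses:
  assumes "nbI_bivaluation \<nu>"
  shows "\<nu> (\<alpha> \<^bold>\<or> \<beta>) \<longleftrightarrow> \<nu> \<alpha> \<or> \<nu> \<beta>"
    and "\<nu> (\<alpha> \<^bold>\<and> \<beta>) \<longleftrightarrow> \<nu> \<alpha> \<and> \<nu> \<beta>"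
    and "\<nu> (\<alpha> \<^bold>\<rightarrow> \<beta>) \<longleftrightarrow> (\<nu> \<alpha> \<longrightarrow> \<nu> \<beta>)"
    and "\<nu> (\<alpha> \<^bold>\<up> \<beta>) \<Longrightarrow> \<not> (\<nu> \<alpha> \<and> \<nu> \<beta>)"
    and "\<nu> (\<alpha> \<^bold>\<up> \<beta>) \<longleftrightarrow> \<nu> (\<beta> \<^bold>\<up> \<alpha>)"
    and "\<not> \<nu> (\<^bold>\<not> \<alpha>) \<Longrightarrow> \<nu> \<alpha>"
proof -
  note biv = assms[unfolded nbI_bivaluation_def]
  show "\<nu> (\<alpha> \<^bold>\<or> \<beta>) \<longleftrightarrow> \<nu> \<alpha> \<or> \<nu> \<beta>"
    by (rule biv[THEN conjunct1, rule_format])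
  show "\<nu> (\<alpha> \<^bold>\<and> \<beta>) \<longleftrightarrow> \<nu> \<alpha> \<and> \<nu> \<beta>"
    by (rule biv[THEN conjunct2, THEN conjunct1, rule_format])
  show "\<nu> (\<alpha> \<^bold>\<rightarrow> \<beta>) \<longleftrightarrow> (\<nu> \<alpha> \<longrightarrow> \<nu> \<beta>)"
    unfolding imp_conv_disj
    by (rule biv[THEN conjunct2, THEN conjunct2, THEN conjunct1, rule_format])
  show "\<not> (\<nu> \<alpha> \<and> \<nu> \<beta>)" if "\<nu> (\<alpha> \<^bold>\<up> \<beta>)"
    unfolding de_Morgan_conj
    by (rule biv[THEN conjunct2, THEN conjunct2, THEN conjunct2, THEN conjunct1, rule_format, OF that])
  show "\<nu> (\<alpha> \<^bold>\<up> \<beta>) \<longleftrightarrow> \<nu> (\<beta> \<^bold>\<up> \<alpha>)"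
    by (rule biv[THEN conjunct2, THEN conjunct2, THEN conjunct2, THEN conjunct2, THEN conjunct1, rule_format])
  show "\<nu> \<alpha>" if "\<not> \<nu> (\<^bold>\<not> \<alpha>)"
    by (rule biv[THEN conjunct2, THEN conjunct2, THEN conjunct2, THEN conjunct2, THEN conjunct2, rule_format, OF that])
qed

lemma nbI_axioms_true:
  assumes biv: "nbI_bivaluation \<nu>" and "\<phi> \<in> nbI_axioms"
  shows "\<nu> \<phi>"
  using assms(2)
proof cases
  case Ip
  then show ?thesis
    using nbI_bivaluation_clauses(4)[OF biv]
    by (simp only: nbI_bivaluation_clauses(3)[OF biv]) blast
next
  case Comm
  then show ?thesis
    by (simp only: nbI_bivaluation_clauses(3,5)[OF biv] simp_thms)
next
  case Ax11
  then show ?thesis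
    using nbI_bivaluation_clauses(6)[OF biv]
    by (simp only: nbI_bivaluation_clauses(1)[OF biv]) blast
qed (simp_all only: nbI_bivaluation_clauses(1-3)[OF biv], blast+)

text \<open>
  The claim concerns every line rather than only the last, since both premises of Modus Ponens
  may sit anywhere before its conclusion; hence complete induction on the position.
\<close>

lemma nbI_derivation_true:
  assumes biv: "nbI_bivaluation \<nu>"
    and prem: "\<forall>\<gamma>\<in>\<Gamma>. \<nu> \<gamma>"
    and der: "nbI_derivation \<Gamma> ds"
    and "i < length ds"
  shows "\<nu> (ds ! i)"
  using \<open>i < length ds\<close>
proof (induction i rule: less_induct)
  case (less i)
  with der consider "ds ! i \<in> \<Gamma>" | "ds ! i \<in> nbI_axioms"
    | j k where "j < i" "k < i" "ds ! k = (ds ! j \<^bold>\<rightarrow> ds ! i)"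
    unfolding nbI_derivation_def by blast
  then show ?case
  proof cases
    case 1
    with prem show ?thesis by blast
  next
    case 2
    with biv show ?thesis by (rule nbI_axioms_true)
  next
    case 3
    have "\<nu> (ds ! j)" and "\<nu> (ds ! k)"
      using 3(1,2) less.prems by (simp_all add: less.IH)
    with 3(3) show ?thesis
      by (simp add: nbI_bivaluation_clauses(3)[OF biv])
  qed
qed

theorem theorem5:
  fixes \<Gamma> :: "'v::countable fm set" and \<phi> :: "'v fm"
  assumes "\<Gamma> \<turnstile>nbI \<phi>"
  shows "\<Gamma> \<Turnstile>nbI \<phi>"
proof -
  obtain ds where "ds \<noteq> []" and der: "nbI_derivation \<Gamma> ds" and "last ds = \<phi>"
    using assms unfolding nbI_derives_def by blast
  then have "\<phi> = ds ! (length ds - 1)" and "length ds - 1 < length ds"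
    by (simp_all add: last_conv_nth)
  with der show ?thesis
    unfolding nbI_entails_def by (simp add: nbI_derivation_true)
qed

end
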